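(* Consider the algorithm D--NC with constant step-size $0<\alpha\le 1/(2L)$ on the problem of minimizing $f=\sum_{i=1}^N f_i$ over $\mathbb{R}^d$, where the weight matrix $W$ satisfies $0<\mu(W)<1$; $f$ has a minimizer $x^\star$, $f^\star=f(x^\star)$; every $f_i:\mathbb{R}^d\to\mathbb{R}$ is convex and differentiable with $\|\nabla f_i(x)-\nabla f_i(y)\|\le L\|x-y\|$ for all $x,y$; and $\|\nabla f_i(x)\|\le G$ for all $x$ and $i$. Let $\|\overline{x}(0)-x^\star\|\le R$, $R\ge 0$. Then, after $$\mathcal{K}=\sum_{t=1}^{k}\left(\tau_x(t)+\tau_y(t)\right)\le\frac{2}{-\log\mu(W)}\left(k\log 3+2(k+1)\log(k+1)\right)=O(k\log k)$$ communication rounds, i.e., after $k$ outer iterations, at any node $i$, $$\frac1N\left(f(x_i(k))-f^\star\right)\le\frac{1}{k^2}\left(\frac{2}{\alpha}R^2+11\,\alpha^2LG^2+\alpha\sqrt{N}\,G^2\right),\qquad k=1,2,\dots$$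
   Context: Network: $N\ge 2$ nodes; $\mathcal{G}=(\mathcal{N},E)$ is a connected, undirected, simple graph on them. $W$ is a symmetric doubly stochastic $N\times N$ matrix with, for $i\ne j$, $W_{ij}>0$ if and only if $\{i,j\}\in E$. $J=\frac1N\mathbf{1}\mathbf{1}^\top$, and $\mu(W)=\|W-J\|$ (spectral norm) is the second largest singular value of $W$. $\|\cdot\|$ is the Euclidean norm for vectors; $1/(2L)$ is read as $+\infty$ if $L=0$. Algorithm D--NC: each node $i$ holds $x_i(k),y_i(k)\in\mathbb{R}^d$; stack $x(k)=(x_1(k)^\top,\dots,x_N(k)^\top)^\top$, $y(k)=(y_1(k)^\top,\dots,y_N(k)^\top)^\top$, and let $\nabla F(y)=(\nabla f_1(y_1)^\top,\dots,\nabla f_N(y_N)^\top)^\top$. All nodes start from a common point: $x_i(0)=y_i(0)=x_j(0)=y_j(0)$ for all $i,j$. For outer iterations $k=1,2,\dots$ $$x(k)=(W\otimes I)^{\tau_x(k)}\left[y(k-1)-\alpha\nabla F(y(k-1))\right],$$ $$y(k)=(W\otimes I)^{\tau_y(k)}\left[x(k)+\beta_{k-1}(x(k)-x(k-1))\right],$$ where $I$ is the $d\times d$ identity, $\beta_k=\frac{k}{k+3}$, and $$\tau_x(k)=\left\lceil\frac{2\log k}{-\log\mu(W)}\right\rceil,\qquad \tau_y(k)=\left\lceil\frac{\log 3}{-\log\mu(W)}+\frac{2\log k}{-\log\mu(W)}\right\rceil .$$ Each multiplication by $W\otimes I$ is one communication round, so outer iteration $k$ uses $\tau_x(k)+\tau_y(k)$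 communication rounds. Further $\overline{x}(k)=\frac1N\sum_{i=1}^N x_i(k)$.
   Formalization: The printed bound on the number of communication rounds fails for very small μ(W) (k=1, μ(W)<1/2304); it is proved with an extra term 2k for all 0<μ(W)<1, and as printed only when μ(W)≥1/12 (not a sharp threshold). *)

theory Defs
  imports "HOL-Analysis.Analysis" "HOL-Library.Landau_Symbols"
begin

definition simple_graph :: "'n set set \<Rightarrow> bool" where
  "simple_graph E \<longleftrightarrow> (\<forall>e\<in>E. \<exists>i j. i \<noteq> j \<and> e = {i, j})"

definition connected_graph :: "'n set set \<Rightarrow> bool" where
  "connected_graph E \<longleftrightarrow> (\<forall>i j. (i, j) \<in> {(u, v). {u, v} \<in> E}\<^sup>*)"

definition doubly_stochastic :: "real^'n^'n \<Rightarrow> bool" where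
  "doubly_stochastic W \<longleftrightarrow>
     (\<forall>i j. 0 \<le> W $ i $ j) \<and>
     (\<forall>i. (\<Sum>j\<in>UNIV. W $ i $ j) = 1) \<and>
     (\<forall>j. (\<Sum>i\<in>UNIV. W $ i $ j) = 1)"

definition weight_matrix :: "'n set set \<Rightarrow> real^'n^'n \<Rightarrow> bool" where
  "weight_matrix E W \<longleftrightarrow>
     transpose W = W \<and> doubly_stochastic W \<and>
     (\<forall>i j. i \<noteq> j \<longrightarrow> (0 < W $ i $ j \<longleftrightarrow> {i, j} \<in> E))"

definition averaging_matrix :: "real^'n^'n" where
  "averaging_matrix = (\<chi> i j. 1 / real CARD('n))"

definition mu :: "real^'n^'n \<Rightarrow> real" where
  "mu W = onorm ((*v) (W - averaging_matrix))"

text \<open>A stacked vector is an element of \<^typ>\<open>real^'d^'n\<close>, whose component \<open>z $ i\<close> is the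
  block of node \<open>i\<close>. \<open>gossip W\<close> is multiplication by the Kronecker product of \<open>W\<close> with
  the \<open>d \<times> d\<close> identity matrix, that is, one communication round.\<close>

definition gossip :: "real^'n^'n \<Rightarrow> real^'d^'n \<Rightarrow> real^'d^'n" where
  "gossip W z = (\<chi> i. \<Sum>j\<in>UNIV. W $ i $ j *\<^sub>R z $ j)"

definition stacked_gradient :: "('n \<Rightarrow> real^'d \<Rightarrow> real^'d) \<Rightarrow> real^'d^'n \<Rightarrow> real^'d^'n" where
  "stacked_gradient gradf z = (\<chi> i. gradf i (z $ i))"

definition node_average :: "real^'d^'n \<Rightarrow> real^'d" where
  "node_average z = (1 / real CARD('n)) *\<^sub>R (\<Sum>i\<in>UNIV. z $ i)"

text \<open>The round counts are only used for \<open>k \<ge> 1\<close> and \<open>0 < mu W < 1\<close>, where the ceilings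
  are nonnegative, so that \<^const>\<open>nat\<close> does not truncate.\<close>

definition tau_x :: "real^'n^'n \<Rightarrow> nat \<Rightarrow> nat" where
  "tau_x W k = nat \<lceil>2 * ln (real k) / - ln (mu W)\<rceil>"

definition tau_y :: "real^'n^'n \<Rightarrow> nat \<Rightarrow> nat" where
  "tau_y W k = nat \<lceil>ln 3 / - ln (mu W) + 2 * ln (real k) / - ln (mu W)\<rceil>"

text \<open>Rounding up makes \<open>comm_rounds W 1 \<ge> 1\<close> however small \<open>mu W\<close> is, so a bound of the
  form \<open>C k / - ln (mu W)\<close> cannot hold uniformly in \<open>mu W\<close> without an additional term for the
  two ceilings per outer iteration.\<close>

definition comm_rounds :: "real^'n^'n \<Rightarrow> nat \<Rightarrow> nat" where
  "comm_rounds W k = (\<Sum>t=1..k. tau_x W t + tau_y W t)"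

definition beta :: "nat \<Rightarrow> real" where
  "beta k = real k / (real k + 3)"

text \<open>The sequences \<open>x\<close> and \<open>y\<close> of stacked vectors are generated by D--NC
  with constant step-size \<open>\<alpha>\<close>, from some common starting point.\<close>

definition D_NC ::
  "real^'n^'n \<Rightarrow> ('n \<Rightarrow> real^'d \<Rightarrow> real^'d) \<Rightarrow> real \<Rightarrow>
    (nat \<Rightarrow> real^'d^'n) \<Rightarrow> (nat \<Rightarrow> real^'d^'n) \<Rightarrow> bool" where
  "D_NC W gradf \<alpha> x y \<longleftrightarrow>
     (\<forall>i j. x 0 $ i = y 0 $ i \<and> y 0 $ i = x 0 $ j \<and> x 0 $ j = y 0 $ j) \<and>
     (\<forall>k\<ge>1.
        x k = (gossip W ^^ tau_x W k) (y (k - 1) - \<alpha> *\<^sub>R stacked_gradient gradf (y (k - 1))) \<and>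
        y k = (gossip W ^^ tau_y W k) (x k + beta (k - 1) *\<^sub>R (x k - x (k - 1))))"

end

theory Submission
  imports Defs "HOL-Real_Asymp.Real_Asymp"
begin

text \<open>
  Averaging over the nodes turns D--NC into Nesterov's method for the mean objective with an inexact
  gradient whose error is \<open>L \<parallel>y - ybar\<parallel>\<^sup>2 / N\<close>. The round counts make the disagreement of \<open>y(k)\<close> at
  most \<open>\<alpha> \<surd>N G / (3 k\<^sup>2)\<close>, so the errors, weighted by \<open>(k + 2)\<^sup>2\<close>, are summable and contribute
  \<open>2 \<alpha>\<^sup>2 L G\<^sup>2 / k\<^sup>2\<close>.

  Passing from the average to a node is the delicate part, since \<open>\<parallel>x - xbar\<parallel>\<close> may exceed
  \<open>\<alpha> \<surd>N G / k\<^sup>2\<close> slightly, so that the bound \<open>G\<close> on the slope of the mean objective is not enough.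
  But if the disagreement is that large, then the local gradients nearly cancel in the mean, so the
  mean objective is flat near \<open>xbar\<close> and steepens only at rate \<open>L \<le> 1 / (2 \<alpha>)\<close>. The first part of
  the way from \<open>xbar\<close> to the node is therefore cheap, which compensates for the excess (for \<open>k = 2\<close>
  with the help of the remaining \<open>9 \<alpha>\<^sup>2 L G\<^sup>2 / k\<^sup>2\<close>).
\<close>

subsection \<open>Convex smooth functions\<close>

lemma gderiv_line:
  fixes f :: "'a::real_inner \<Rightarrow> real"
  assumes "\<And>z. GDERIV f z :> gf z"
  shows "((\<lambda>t. f (u + t *\<^sub>R v)) has_real_derivative (v \<bullet> gf (u + t *\<^sub>R v))) (at t)"
proof -
  have "((\<lambda>t. u + t *\<^sub>R v) has_derivative (\<lambda>t. t *\<^sub>R v)) (at t)"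
    by (auto intro!: derivative_eq_intros)
  moreover have "(f has_derivative (\<lambda>h. h \<bullet> gf (u + t *\<^sub>R v))) (at (u + t *\<^sub>R v))"
    using assms by (simp add: gderiv_def)
  ultimately have "((\<lambda>t. f (u + t *\<^sub>R v)) has_derivative (\<lambda>h. (h *\<^sub>R v) \<bullet> gf (u + t *\<^sub>R v))) (at t)"
    by (rule has_derivative_compose)
  thus ?thesis
    by (simp add: has_field_derivative_def mult_commute_abs)
qed

lemma convex_above_tangent:
  fixes f :: "'a::real_inner \<Rightarrow> real"
  assumes "convex_on UNIV f" and gf: "\<And>z. GDERIV f z :> gf z"
  shows "f u + gf u \<bullet> (v - u) \<le> f v"
proof -
  let ?h = "\<lambda>t. f (u + t *\<^sub>R (v - u))"
  have "convex_on UNIV ?h"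
  proof (rule convex_onI)
    fix t a b :: real assume "0 < t" "t < 1"
    have "u + ((1 - t) *\<^sub>R a + t *\<^sub>R b) *\<^sub>R (v - u)
        = (1 - t) *\<^sub>R (u + a *\<^sub>R (v - u)) + t *\<^sub>R (u + b *\<^sub>R (v - u))"
      by (simp add: algebra_simps)
    thus "?h ((1 - t) *\<^sub>R a + t *\<^sub>R b) \<le> (1 - t) * ?h a + t * ?h b"
      using convex_onD[OF assms(1), of t] \<open>0 < t\<close> \<open>t < 1\<close> by simp
  qed simp
  moreover have "(?h has_real_derivative ((v - u) \<bullet> gf u)) (at 0 within UNIV)"
    using gderiv_line[OF gf, of u "v - u" 0] by simp
  ultimately have "?h 1 - ?h 0 \<ge> ((v - u) \<bullet> gf u) * (1 - 0)"
    by (intro convex_on_imp_above_tangent[where A = UNIV]) auto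
  thus ?thesis by (simp add: inner_commute)
qed

lemma descent_lemma:
  fixes f :: "'a::real_inner \<Rightarrow> real"
  assumes gf: "\<And>z. GDERIV f z :> gf z"
    and lip: "\<And>u v. norm (gf u - gf v) \<le> L * norm (u - v)"
  shows "f v \<le> f u + gf u \<bullet> (v - u) + L / 2 * (norm (v - u))\<^sup>2"
proof -
  define d where "d = v - u"
  \<comment> \<open>The gap between \<open>f\<close> and its quadratic model along the segment; the
    Lipschitz gradient makes its derivative nonpositive.\<close>
  define h where "h t = f (u + t *\<^sub>R d) - t * (d \<bullet> gf u) - L / 2 * t\<^sup>2 * (norm d)\<^sup>2" for t
  have "h 1 \<le> h 0"
  proof (rule DERIV_nonpos_imp_nonincreasing[of 0 1 h])
    fix t :: real assume t: "0 \<le> t" "t \<le> 1"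
    have "(h has_real_derivative (d \<bullet> gf (u + t *\<^sub>R d) - d \<bullet> gf u - L * t * (norm d)\<^sup>2)) (at t)"
      unfolding h_def by (auto intro!: derivative_eq_intros gderiv_line gf simp: algebra_simps)
    moreover have "d \<bullet> gf (u + t *\<^sub>R d) - d \<bullet> gf u \<le> L * t * (norm d)\<^sup>2"
    proof -
      have "d \<bullet> gf (u + t *\<^sub>R d) - d \<bullet> gf u = d \<bullet> (gf (u + t *\<^sub>R d) - gf u)"
        by (simp add: inner_diff_right)
      also have "\<dots> \<le> norm d * norm (gf (u + t *\<^sub>R d) - gf u)"
        by (rule norm_cauchy_schwarz)
      also have "\<dots> \<le> norm d * (L * norm (t *\<^sub>R d))"
        using lip[of "u + t *\<^sub>R d" u] by (intro mult_left_mono) auto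
      finally show ?thesis using t by (simp add: power2_eq_square mult_ac)
    qed
    ultimately show "\<exists>y. (h has_real_derivative y) (at t) \<and> y \<le> 0" by force
  qed simp
  thus ?thesis by (simp add: h_def d_def inner_commute)
qed

subsection \<open>Gossip and disagreement\<close>

text \<open>The orthogonal projection off the consensus vectors, that is,
  \<open>I - averaging_matrix\<close> tensored with the identity.\<close>

definition deviation :: "real^'d^'n \<Rightarrow> real^'d^'n" where
  "deviation z = (\<chi> i. z $ i - node_average z)"

lemma node_average_add: "node_average (u + v) = node_average u + node_average v"
  and node_average_diff: "node_average (u - v) = node_average u - node_average v"
  and node_average_scaleR: "node_average (c *\<^sub>R u) = c *\<^sub>R node_average u"
  by (simp_all add: node_average_def sum.distrib sum_subtractf scaleR_right_distrib
      scaleR_right_diff_distrib scaleR_sum_right mult.commute)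

lemma deviation_add: "deviation (u + v) = deviation u + deviation v"
  and deviation_diff: "deviation (u - v) = deviation u - deviation v"
  and deviation_scaleR: "deviation (c *\<^sub>R u) = c *\<^sub>R deviation u"
  by (simp_all add: deviation_def vec_eq_iff node_average_add node_average_diff
      node_average_scaleR algebra_simps)

lemma sum_eq_node_average: "(\<Sum>i\<in>UNIV. z $ i) = real CARD('n) *\<^sub>R node_average (z :: real^'d^'n)"
  by (simp add: node_average_def)

lemma sum_deviation: "(\<Sum>i\<in>UNIV. deviation z $ i) = 0"
  by (simp add: deviation_def sum_subtractf sum_eq_node_average sum_constant_scaleR del: sum_constant)

lemma norm_vec_squared: "(norm (z :: real^'d^'n))\<^sup>2 = (\<Sum>i\<in>UNIV. (norm (z $ i))\<^sup>2)"
  by (simp add: norm_vec_def L2_set_def sum_nonneg)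

text \<open>Pythagoras: the deviation is orthogonal to the consensus part.\<close>

lemma norm_deviation_squared:
  fixes z :: "real^'d^'n"
  shows "(norm (deviation z))\<^sup>2 = (norm z)\<^sup>2 - real CARD('n) * (norm (node_average z))\<^sup>2"
proof -
  let ?a = "node_average z"
  have "(norm (deviation z))\<^sup>2 = (\<Sum>i\<in>UNIV. (norm (z $ i))\<^sup>2 - 2 * (z $ i \<bullet> ?a) + (norm ?a)\<^sup>2)"
    unfolding norm_vec_squared by (simp add: deviation_def power2_norm_eq_inner inner_diff inner_commute algebra_simps)
  also have "\<dots> = (norm z)\<^sup>2 - 2 * ((\<Sum>i\<in>UNIV. z $ i) \<bullet> ?a) + real CARD('n) * (norm ?a)\<^sup>2"
    by (simp add: norm_vec_squared sum.distrib sum_subtractf inner_sum_left sum_distrib_left)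
  also have "(\<Sum>i\<in>UNIV. z $ i) \<bullet> ?a = real CARD('n) * (norm ?a)\<^sup>2"
    by (simp add: sum_eq_node_average power2_norm_eq_inner)
  finally show ?thesis by simp
qed

lemma norm_node_average_le:
  fixes z :: "real^'d^'n"
  assumes "\<And>i. norm (z $ i) \<le> c"
  shows "norm (node_average z) \<le> c"
proof -
  have "norm (\<Sum>i\<in>UNIV. z $ i) \<le> (\<Sum>i\<in>(UNIV::'n set). c)"
    using assms by (intro sum_norm_le) auto
  thus ?thesis by (simp add: node_average_def divide_simps mult.commute)
qed

lemma mean_norm_le:
  fixes z :: "real^'d^'n"
  shows "(\<Sum>i\<in>UNIV. norm (z $ i)) \<le> sqrt (real CARD('n)) * norm z"
proof -
  have "(\<Sum>i\<in>UNIV. norm (z $ i))\<^sup>2 \<le> (\<Sum>i\<in>UNIV. (norm (z $ i))\<^sup>2) * (\<Sum>i\<in>(UNIV::'n set). 1\<^sup>2)"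
    using Cauchy_Schwarz_ineq_sum[of "\<lambda>i. norm (z $ i)" "\<lambda>_. 1" "UNIV :: 'n set"] by simp
  also have "\<dots> = (sqrt (real CARD('n)) * norm z)\<^sup>2"
    by (simp add: norm_vec_squared power_mult_distrib)
  finally show ?thesis by (rule power2_le_imp_le) simp
qed

lemma gossip_component: "gossip A z $ i $ c = (A *v (\<chi> j. z $ j $ c)) $ i"
  by (simp add: gossip_def matrix_vector_mult_def)

text \<open>Tensoring with the identity lets \<open>A\<close> act separately on each coordinate
  slice, so its operator norm carries over.\<close>

lemma norm_gossip_le:
  fixes z :: "real^'d^'n"
  shows "norm (gossip A z) \<le> onorm ((*v) A) * norm z"
proof -
  have norm_cols: "(norm v)\<^sup>2 = (\<Sum>c\<in>UNIV. (norm (\<chi> j. v $ j $ c))\<^sup>2)" for v :: "real^'d^'n"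
    by (simp add: norm_vec_squared[of v] norm_vec_def L2_set_def sum_nonneg) (rule sum.swap)
  have pos: "0 \<le> onorm ((*v) A)"
    by (intro onorm_pos_le matrix_vector_mul_bounded_linear)
  have "(norm (gossip A z))\<^sup>2 = (\<Sum>c\<in>UNIV. (norm (A *v (\<chi> j. z $ j $ c)))\<^sup>2)"
    unfolding norm_cols[of "gossip A z"] by (simp add: gossip_component)
  also have "\<dots> \<le> (\<Sum>c\<in>UNIV. (onorm ((*v) A) * norm (\<chi> j. z $ j $ c))\<^sup>2)"
    by (intro sum_mono power_mono onorm matrix_vector_mul_bounded_linear) simp
  also have "\<dots> = (onorm ((*v) A) * norm z)\<^sup>2"
    by (simp add: power_mult_distrib norm_cols[of z] sum_distrib_left)
  finally show ?thesis
    by (rule power2_le_imp_le) (simp add: pos)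
qed

context
  fixes W :: "real^'n^'n"
  assumes W: "doubly_stochastic W"
begin

lemma node_average_gossip: "node_average (gossip W z) = node_average z"
proof -
  have "(\<Sum>i\<in>UNIV. \<Sum>j\<in>UNIV. W $ i $ j *\<^sub>R z $ j) = (\<Sum>j\<in>UNIV. (\<Sum>i\<in>UNIV. W $ i $ j) *\<^sub>R z $ j)"
    by (subst sum.swap) (simp add: scaleR_left.sum)
  thus ?thesis using W by (simp add: node_average_def gossip_def doubly_stochastic_def)
qed

lemma node_average_gossip_funpow: "node_average ((gossip W ^^ m) z) = node_average z"
  by (induction m) (simp_all add: node_average_gossip)

text \<open>The averaging matrix kills deviations, whose blocks sum to zero, and \<open>W\<close>
  fixes consensus vectors. Hence each round shrinks the disagreement by the factor
  \<open>mu W\<close>.\<close>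

lemma deviation_gossip: "deviation (gossip W z) = gossip (W - averaging_matrix) (deviation z)"
proof -
  have "gossip (W - averaging_matrix) (deviation z) $ i = deviation (gossip W z) $ i" for i
  proof -
    have "gossip (W - averaging_matrix) (deviation z) $ i
        = (\<Sum>j\<in>UNIV. W $ i $ j *\<^sub>R deviation z $ j) - (1 / real CARD('n)) *\<^sub>R (\<Sum>j\<in>UNIV. deviation z $ j)"
      by (simp add: gossip_def averaging_matrix_def scaleR_left_diff_distrib sum_subtractf scaleR_sum_right)
    also have "\<dots> = (\<Sum>j\<in>UNIV. W $ i $ j *\<^sub>R z $ j) - (\<Sum>j\<in>UNIV. W $ i $ j) *\<^sub>R node_average z"
      unfolding sum_deviation
      by (simp add: deviation_def scaleR_right_diff_distrib sum_subtractf scaleR_left.sum)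
    also have "\<dots> = deviation (gossip W z) $ i"
      using W by (simp add: deviation_def node_average_gossip doubly_stochastic_def) (simp add: gossip_def)
    finally show ?thesis .
  qed
  thus ?thesis by (simp add: vec_eq_iff)
qed

lemma norm_deviation_gossip_funpow:
  "norm (deviation ((gossip W ^^ m) z)) \<le> mu W ^ m * norm (deviation z)"
proof (induction m)
  case (Suc m)
  have "norm (deviation ((gossip W ^^ Suc m) z)) \<le> mu W * norm (deviation ((gossip W ^^ m) z))"
    unfolding mu_def by (simp add: deviation_gossip norm_gossip_le)
  also have "\<dots> \<le> mu W * (mu W ^ m * norm (deviation z))"
    using Suc unfolding mu_def
    by (intro mult_left_mono onorm_pos_le matrix_vector_mul_bounded_linear)
  finally show ?case by simp
qed simp

text \<open>The rows of \<open>W\<close> are convex weights. Unlike a spectral estimate, this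
  blockwise one costs no factor sqrt N.\<close>

lemma norm_gossip_funpow_component:
  assumes "\<And>j. norm (z $ j) \<le> c"
  shows "norm ((gossip W ^^ m) z $ i) \<le> c"
proof (induction m arbitrary: i)
  case (Suc m)
  have "norm ((gossip W ^^ Suc m) z $ i) \<le> (\<Sum>j\<in>UNIV. W $ i $ j * c)"
    using W unfolding funpow.simps o_apply gossip_def[of W "(gossip W ^^ m) z"] vec_lambda_beta
    by (intro sum_norm_le) (simp add: Suc mult_left_mono doubly_stochastic_def)
  also have "\<dots> = c"
    using W by (simp add: doubly_stochastic_def flip: sum_distrib_right)
  finally show ?case .
qed (simp add: assms)

end

lemma gossip_diff: "gossip A (u - v) = gossip A u - gossip A v"
  and gossip_scaleR: "gossip A (c *\<^sub>R u) = c *\<^sub>R gossip A u"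
  by (simp_all add: gossip_def vec_eq_iff right_diff_distrib sum_subtractf sum_distrib_left mult_ac)

lemma gossip_funpow_diff: "(gossip A ^^ m) (u - v) = (gossip A ^^ m) u - (gossip A ^^ m) v"
  by (induction m) (simp_all add: gossip_diff)

lemma gossip_funpow_scaleR: "(gossip A ^^ m) (c *\<^sub>R u) = c *\<^sub>R (gossip A ^^ m) u"
  by (induction m) (simp_all add: gossip_scaleR)

subsection \<open>Communication rounds\<close>

text \<open>One-sided Stirling estimate. The summand \<open>real k\<close> is slack that absorbs the
  ceilings in \<open>comm_rounds_le'\<close>.\<close>

lemma ln_fact_le: "2 * (ln (fact k) + real k) \<le> 2 * (real k + 1) * ln (real k + 1)"
proof (induction k)
  case (Suc k)
  have "ln (real k + 1) + 1 / (real k + 2) \<le> ln (real k + 2)"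
    using ln_le_minus_one[of "(real k + 1) / (real k + 2)"]
    by (simp add: ln_div field_simps)
  hence "(real k + 2) * (ln (real k + 1) + 1 / (real k + 2)) \<le> (real k + 2) * ln (real k + 2)"
    by (intro mult_left_mono) auto
  hence "(real k + 2) * ln (real k + 1) + 1 \<le> (real k + 2) * ln (real k + 2)"
    by (simp add: distrib_left)
  moreover have "ln (fact (Suc k)) = ln (real k + 1) + ln (fact k :: real)"
    by (simp add: ln_mult add.commute)
  ultimately show ?case using Suc by (simp add: algebra_simps)
qed simp

context
  fixes W :: "real^'n^'n"
  assumes mu: "0 < mu W" "mu W < 1"
begin

lemma mu_power_le:
  assumes "0 < c" and "ln c / - ln (mu W) \<le> real m"
  shows "mu W ^ m \<le> 1 / c"
proof -
  have "0 < - ln (mu W)" using mu by simp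
  hence "ln (mu W ^ m) \<le> ln (1 / c)"
    using assms mu by (simp add: ln_realpow ln_div field_simps)
  thus ?thesis using mu assms by (subst (asm) ln_le_cancel_iff) auto
qed

lemma mu_power_tau_x: "1 \<le> k \<Longrightarrow> mu W ^ tau_x W k \<le> 1 / (real k)\<^sup>2"
  by (rule mu_power_le) (auto simp: tau_x_def ln_realpow intro: real_nat_ceiling_ge)

lemma mu_power_tau_y: "1 \<le> k \<Longrightarrow> mu W ^ tau_y W k \<le> 1 / (3 * (real k)\<^sup>2)"
  by (rule mu_power_le)
    (auto simp: tau_y_def ln_realpow ln_mult add_divide_distrib simp flip: divide_minus_right intro: real_nat_ceiling_ge)

lemma tau_sum_le:
  assumes "1 \<le> t"
  shows "real (tau_x W t + tau_y W t) \<le> (ln 3 + 4 * ln (real t)) / - ln (mu W) + 2"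
proof -
  have l: "0 < - ln (mu W)" using mu by simp
  have le: "real (nat \<lceil>a\<rceil>) \<le> a + 1" if "0 \<le> a" for a :: real
    using that by linarith
  have "real (tau_x W t) \<le> 2 * ln (real t) / - ln (mu W) + 1"
    unfolding tau_x_def using l assms by (intro le divide_nonneg_pos) auto
  moreover have "real (tau_y W t) \<le> ln 3 / - ln (mu W) + 2 * ln (real t) / - ln (mu W) + 1"
    unfolding tau_y_def using l assms by (intro le add_nonneg_nonneg divide_nonneg_pos) auto
  ultimately show ?thesis using l by (simp add: field_simps)
qed

lemma comm_rounds_le_ln_fact:
  "real (comm_rounds W k) \<le> (real k * ln 3 + 4 * ln (fact k)) / - ln (mu W) + 2 * real k"
proof -
  have "real (comm_rounds W k) \<le> (\<Sum>t=1..k. (ln 3 + 4 * ln (real t)) / - ln (mu W) + 2)"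
    unfolding comm_rounds_def of_nat_sum by (intro sum_mono tau_sum_le) auto
  also have "\<dots> = (real k * ln 3 + 4 * (\<Sum>t=1..k. ln (real t))) / - ln (mu W) + 2 * real k"
    by (simp only: sum.distrib sum_constant card_atLeastAtMost flip: sum_distrib_left sum_divide_distrib)
      simp
  also have "(\<Sum>t=1..k. ln (real t)) = ln (fact k)"
    by (induction k) (simp_all add: ln_mult)
  finally show ?thesis .
qed

lemma comm_rounds_le:
  "real (comm_rounds W k) \<le> 2 / - ln (mu W) *
     (real k * ln 3 + 2 * (real k + 1) * ln (real k + 1)) + 2 * real k"
proof -
  have l: "0 < - ln (mu W)" using mu by simp
  have "(real k * ln 3 + 4 * ln (fact k)) / - ln (mu W)
      \<le> 2 * (real k * ln 3 + 2 * (real k + 1) * ln (real k + 1)) / - ln (mu W)"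
  proof (rule divide_right_mono)
    have "0 \<le> real k * ln 3" by simp
    thus "real k * ln 3 + 4 * ln (fact k) \<le> 2 * (real k * ln 3 + 2 * (real k + 1) * ln (real k + 1))"
      using ln_fact_le[of k] by (smt (verit) mult.assoc of_nat_0_le_iff)
  qed (use l in simp)
  thus ?thesis using comm_rounds_le_ln_fact[of k] by simp
qed

text \<open>With l = - ln (mu W), the target exceeds the count without ceilings by at least k (4 +
  ln 3) / l. The ceilings cost 2 k, which fits if 2 l \<le> 4 + ln 3; the threshold 1/12 ensures
  this.\<close>

lemma comm_rounds_le':
  assumes "1 / 12 \<le> mu W"
  shows "real (comm_rounds W k) \<le> 2 / - ln (mu W) *
     (real k * ln 3 + 2 * (real k + 1) * ln (real k + 1))"
proof -
  define l where "l = - ln (mu W)"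
  have l: "0 < l" using mu by (simp add: l_def)
  have "ln (1 / 12) \<le> ln (mu W)" using assms mu by (subst ln_le_cancel_iff) auto
  hence "l \<le> ln 12" by (simp add: l_def ln_div)
  \<comment> \<open>As 144 = 48 * 3, this amounts to 48 \<le> exp 4. Taking exp 4 as the 8th power
    of exp (1/2) makes the quadratic Taylor bound sharp enough.\<close>
  moreover have "2 * ln 12 \<le> 4 + ln (3::real)"
  proof -
    have "(48::real) \<le> (1 + 1 / 2 + (1 / 2)\<^sup>2 / 2) ^ 8"
      by (simp add: power2_eq_square power_divide)
    also have "\<dots> \<le> exp (1 / 2) ^ 8"
      by (intro power_mono exp_lower_Taylor_quadratic) auto
    also have "\<dots> = exp 4"
      by (simp flip: exp_of_nat_mult)
    finally have "48 \<le> exp (4::real)" .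
    hence "ln 48 \<le> ln (exp (4::real))" by (subst ln_le_cancel_iff) auto
    moreover have "2 * ln 12 = ln 48 + ln (3::real)" 
      using ln_realpow[of 12 2] ln_mult_pos[of 48 3] by simp
    ultimately show ?thesis by simp
  qed
  ultimately have "2 * l \<le> 4 + ln 3" by linarith
  hence "real k * (2 * l) \<le> real k * (4 + ln 3)" by (rule mult_left_mono) simp
  hence "2 * real k \<le> real k * (4 + ln 3) / l" using l by (simp add: field_simps)
  moreover have "(real k * ln 3 + 4 * ln (fact k)) / l + real k * (4 + ln 3) / l
      \<le> 2 * (real k * ln 3 + 2 * (real k + 1) * ln (real k + 1)) / l"
    unfolding add_divide_distrib[symmetric]
  proof (rule divide_right_mono)
    show "real k * ln 3 + 4 * ln (fact k) + real k * (4 + ln 3)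
        \<le> 2 * (real k * ln 3 + 2 * (real k + 1) * ln (real k + 1))"
      using ln_fact_le[of k] by (simp add: distrib_left[of _ "real k * ln 3"] distrib_left[of _ 4])
  qed (use l in simp)
  ultimately show ?thesis using comm_rounds_le_ln_fact[of k] by (simp add: l_def)
qed

lemma comm_rounds_bigo: "(\<lambda>k. real (comm_rounds W k)) \<in> O(\<lambda>k. real k * ln (real k))"
proof -
  have "(\<lambda>k. real (comm_rounds W k)) \<in> O(\<lambda>k. 2 / - ln (mu W) *
     (real k * ln 3 + 2 * (real k + 1) * ln (real k + 1)) + 2 * real k)"
    by (intro landau_o.big_mono always_eventually allI)
      (metis abs_ge_self abs_of_nat comm_rounds_le order_trans real_norm_def)
  also have "(\<lambda>k. 2 / - ln (mu W) * (real k * ln 3 + 2 * (real k + 1) * ln (real k + 1)) + 2 * real k)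
      \<in> O(\<lambda>k. real k * ln (real k))"
  proof (rule sum_in_bigo(1))
    have "(\<lambda>k. real k * ln 3 + 2 * (real k + 1) * ln (real k + 1)) \<in> O(\<lambda>k. real k * ln (real k))"
      by real_asymp
    thus "(\<lambda>k. 2 / - ln (mu W) * (real k * ln 3 + 2 * (real k + 1) * ln (real k + 1)))
        \<in> O(\<lambda>k. real k * ln (real k))"
      using mu by (subst landau_o.big.cmult_in_iff) auto
    show "(\<lambda>k. 2 * real k) \<in> O(\<lambda>k. real k * ln (real k))"
      by real_asymp
  qed
  finally show ?thesis .
qed

end

subsection \<open>The D--NC iteration\<close>

text \<open>The terms for \<open>s = 0\<close> and \<open>k = 0\<close> vanish because of \<open>1 / 0 = 0\<close>.\<close>

lemma sum_inverse_squares_le: "(\<Sum>s\<le>k. 1 / (real s)\<^sup>2) \<le> 2 - 1 / real k"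
proof (induction k)
  case (Suc k)
  have "1 / (real (Suc k))\<^sup>2 + 1 / real (Suc k) \<le> 1 / real k" if "k \<noteq> 0"
    using that by (simp add: divide_simps power2_eq_square) (simp add: algebra_simps)
  thus ?case using Suc by (cases "k = 0") auto
qed simp

lemma norm_diff_squared_le:
  fixes a b :: "'a::real_inner"
  shows "(norm (a - b))\<^sup>2 \<le> 2 * (norm a)\<^sup>2 + 2 * (norm b)\<^sup>2"
  using zero_le_power2[of "norm (a + b)"] unfolding power2_norm_eq_inner
  by (simp add: inner_add inner_diff inner_commute[of b a])

text \<open>\<open>M\<close> bounds the norm of \<alpha> times a stacked gradient and is the unit of
  all disagreement bounds. The product form of \<open>step_size\<close> covers L = 0.\<close>

locale dnc_run =
  fixes W :: "real^'n^'n"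
    and f :: "'n \<Rightarrow> real^'d \<Rightarrow> real"
    and gradf :: "'n \<Rightarrow> real^'d \<Rightarrow> real^'d"
    and x y :: "nat \<Rightarrow> real^'d^'n"
    and \<alpha> L G M :: real
    and xstar :: "real^'d"
  assumes stoch: "doubly_stochastic W"
    and mu: "0 < mu W" "mu W < 1"
    and convex: "\<And>i. convex_on UNIV (f i)"
    and grad: "\<And>i z. GDERIV (f i) z :> gradf i z"
    and lip: "\<And>i u v. norm (gradf i u - gradf i v) \<le> L * norm (u - v)"
    and bounded_grad: "\<And>i z. norm (gradf i z) \<le> G"
    and minimizer: "\<And>z. (\<Sum>i\<in>UNIV. f i xstar) \<le> (\<Sum>i\<in>UNIV. f i z)"
    and alpha_pos: "0 < \<alpha>"
    and L_nonneg: "0 \<le> L"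
    and step_size: "\<alpha> * L \<le> 1 / 2"
    and M_def: "M = \<alpha> * (sqrt (real CARD('n)) * G)"
    and run: "D_NC W gradf \<alpha> x y"
begin

section \<open>Averages over the nodes and their recursions\<close>

abbreviation xbar :: "nat \<Rightarrow> real^'d" where "xbar k \<equiv> node_average (x k)"
abbreviation ybar :: "nat \<Rightarrow> real^'d" where "ybar k \<equiv> node_average (y k)"
abbreviation g :: "nat \<Rightarrow> real^'d^'n" where "g k \<equiv> stacked_gradient gradf (y k)"
abbreviation gbar :: "nat \<Rightarrow> real^'d" where "gbar k \<equiv> node_average (g k)"

text \<open>Dividing by N lets the slope bound \<open>G\<close> and the smoothness constant
  \<open>L\<close> of one summand carry over unchanged.\<close>

definition fmean :: "real^'d \<Rightarrow> real" where
  "fmean z = (\<Sum>j\<in>UNIV. f j z) / real CARD('n)"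

definition gmean :: "real^'d \<Rightarrow> real^'d" where
  "gmean z = node_average (\<chi> j. gradf j z)"

lemma G_nonneg: "0 \<le> G"
  using bounded_grad norm_ge_zero order_trans by blast

lemma x_Suc: "x (Suc k) = (gossip W ^^ tau_x W (Suc k)) (y k - \<alpha> *\<^sub>R g k)"
  using run unfolding D_NC_def by (metis One_nat_def diff_Suc_1 le_add1 plus_1_eq_Suc)

lemma y_Suc: "y (Suc k) = (gossip W ^^ tau_y W (Suc k)) (x (Suc k) + beta k *\<^sub>R (x (Suc k) - x k))"
  using run unfolding D_NC_def by (metis One_nat_def diff_Suc_1 le_add1 plus_1_eq_Suc)

lemma xbar_Suc: "xbar (Suc k) = ybar k - \<alpha> *\<^sub>R gbar k"
  by (simp add: x_Suc node_average_gossip_funpow[OF stoch] node_average_diff node_average_scaleR)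

lemma ybar_Suc: "ybar (Suc k) = xbar (Suc k) + beta k *\<^sub>R (xbar (Suc k) - xbar k)"
  by (subst y_Suc) (simp only: node_average_gossip_funpow[OF stoch] node_average_add node_average_diff node_average_scaleR)

lemma y_0: "y 0 = x 0"
  using run by (simp add: D_NC_def vec_eq_iff)

lemma deviation_0: "deviation (x 0) = 0" "deviation (y 0) = 0"
proof -
  have "x 0 $ i = x 0 $ j" for i j
    using run unfolding D_NC_def by metis
  hence "node_average (x 0) = x 0 $ i" for i
    using norm_node_average_le[of "\<chi> j. x 0 $ j - x 0 $ i" 0]
    by (simp add: node_average_def sum_subtractf sum_constant_scaleR scaleR_right_diff_distrib del: sum_constant)
  thus "deviation (x 0) = 0" "deviation (y 0) = 0"
    by (auto simp: y_0 deviation_def vec_eq_iff)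
qed

section \<open>Decay of the disagreement\<close>

lemma norm_gbar: "norm (gbar k) \<le> G"
  by (rule norm_node_average_le) (simp add: stacked_gradient_def bounded_grad)

text \<open>By Pythagoras, a large mean gradient leaves little room for disagreement among local
  gradients; the passage to a single node exploits this trade-off.\<close>

lemma norm_deviation_g: "(norm (deviation (g k)))\<^sup>2 \<le> real CARD('n) * (G\<^sup>2 - (norm (gbar k))\<^sup>2)"
proof -
  have "(norm (g k))\<^sup>2 \<le> (\<Sum>i\<in>(UNIV::'n set). G\<^sup>2)"
    unfolding norm_vec_squared
    by (intro sum_mono power_mono) (auto simp: stacked_gradient_def bounded_grad)
  thus ?thesis by (simp add: norm_deviation_squared right_diff_distrib)
qed

lemma norm_deviation_x:
  "norm (deviation (x (Suc k))) \<le> (norm (deviation (y k)) + \<alpha> * norm (deviation (g k))) / (real (Suc k))\<^sup>2"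
proof -
  have "norm (deviation (x (Suc k))) \<le> mu W ^ tau_x W (Suc k) * norm (deviation (y k - \<alpha> *\<^sub>R g k))"
    unfolding x_Suc by (rule norm_deviation_gossip_funpow[OF stoch])
  also have "\<dots> \<le> 1 / (real (Suc k))\<^sup>2 * (norm (deviation (y k)) + \<alpha> * norm (deviation (g k)))"
  proof (rule mult_mono)
    show "mu W ^ tau_x W (Suc k) \<le> 1 / (real (Suc k))\<^sup>2"
      by (rule mu_power_tau_x[OF mu]) simp
    show "norm (deviation (y k - \<alpha> *\<^sub>R g k)) \<le> norm (deviation (y k)) + \<alpha> * norm (deviation (g k))"
      using norm_triangle_ineq4[of "deviation (y k)" "\<alpha> *\<^sub>R deviation (g k)"] alpha_pos
      by (simp add: deviation_diff deviation_scaleR)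
  qed auto
  finally show ?thesis by simp
qed

lemma norm_deviation_y:
  "norm (deviation (y (Suc k))) \<le>
     ((1 + beta k) * norm (deviation (x (Suc k))) + beta k * norm (deviation (x k))) / (3 * (real (Suc k))\<^sup>2)"
proof -
  have beta: "0 \<le> beta k" by (simp add: beta_def)
  have "norm (deviation (y (Suc k)))
      \<le> mu W ^ tau_y W (Suc k) * norm (deviation (x (Suc k) + beta k *\<^sub>R (x (Suc k) - x k)))"
    unfolding y_Suc by (rule norm_deviation_gossip_funpow[OF stoch])
  also have "\<dots> \<le> 1 / (3 * (real (Suc k))\<^sup>2)
      * ((1 + beta k) * norm (deviation (x (Suc k))) + beta k * norm (deviation (x k)))"
  proof (rule mult_mono)
    show "mu W ^ tau_y W (Suc k) \<le> 1 / (3 * (real (Suc k))\<^sup>2)"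
      by (rule mu_power_tau_y[OF mu]) simp
    have "deviation (x (Suc k) + beta k *\<^sub>R (x (Suc k) - x k))
        = (1 + beta k) *\<^sub>R deviation (x (Suc k)) - beta k *\<^sub>R deviation (x k)"
      by (simp add: deviation_add deviation_diff deviation_scaleR algebra_simps)
    thus "norm (deviation (x (Suc k) + beta k *\<^sub>R (x (Suc k) - x k)))
        \<le> (1 + beta k) * norm (deviation (x (Suc k))) + beta k * norm (deviation (x k))"
      using norm_triangle_ineq4[of "(1 + beta k) *\<^sub>R deviation (x (Suc k))" "beta k *\<^sub>R deviation (x k)"] beta
      by simp
  qed auto
  finally show ?thesis by simp
qed

lemma M_nonneg: "0 \<le> M"
  using G_nonneg alpha_pos by (simp add: M_def)

lemma norm_deviation_x_le:
  assumes "norm (deviation (y k)) \<le> b * M"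
  shows "norm (deviation (x (Suc k))) \<le> (1 + b) * M / (real (Suc k))\<^sup>2"
proof -
  have "real CARD('n) * (G\<^sup>2 - (norm (gbar k))\<^sup>2) \<le> real CARD('n) * G\<^sup>2"
    by (intro mult_left_mono) auto
  hence "(norm (deviation (g k)))\<^sup>2 \<le> (sqrt (real CARD('n)) * G)\<^sup>2"
    using order_trans[OF norm_deviation_g[of k]] by (simp add: power_mult_distrib)
  hence "norm (deviation (g k)) \<le> sqrt (real CARD('n)) * G"
    by (rule power2_le_imp_le) (simp add: G_nonneg)
  hence "\<alpha> * norm (deviation (g k)) \<le> M"
    using alpha_pos unfolding M_def by (intro mult_left_mono) auto
  hence "norm (deviation (y k)) + \<alpha> * norm (deviation (g k)) \<le> (1 + b) * M"
    using assms by (simp add: distrib_right)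
  thus ?thesis
    using norm_deviation_x[of k] by (meson divide_right_mono order_trans zero_le_power2)
qed

text \<open>From the common start, only the first gradient step creates disagreement, and
  \<open>beta 0 = 0\<close> removes the extrapolation.\<close>

lemma norm_deviation_first:
  "norm (deviation (x 1)) \<le> M" "norm (deviation (y 1)) \<le> 1 / 3 * M"
  using norm_deviation_x_le[of 0 0] norm_deviation_y[of 0]
  by (simp_all add: deviation_0 beta_def)

text \<open>The weights 1 + beta and beta sum to at most 3, which the bounds M / 3 balance; the ln 3
  in \<open>tau_y\<close> supplies the 3 in the conclusion.\<close>

lemma norm_deviation_y_le:
  assumes "norm (deviation (x (Suc k))) \<le> 1 / 3 * M" "norm (deviation (x k)) \<le> 1 / 3 * M"
  shows "norm (deviation (y (Suc k))) \<le> M / (3 * (real (Suc k))\<^sup>2)"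
proof -
  have beta: "0 \<le> beta k" "beta k \<le> 1" by (simp_all add: beta_def)
  have "(1 + beta k) * norm (deviation (x (Suc k))) + beta k * norm (deviation (x k))
      \<le> (1 + 1) * (1 / 3 * M) + 1 * (1 / 3 * M)"
    using beta assms by (intro add_mono mult_mono) auto
  hence "((1 + beta k) * norm (deviation (x (Suc k))) + beta k * norm (deviation (x k))) / (3 * (real (Suc k))\<^sup>2)
      \<le> M / (3 * (real (Suc k))\<^sup>2)"
    by (intro divide_right_mono) auto
  thus ?thesis using norm_deviation_y[of k] by linarith
qed

text \<open>The constants are what the recursion gives at k = 2: (1 + 1/3) / 4 = 1/3 and, with
  \<open>beta 1 = 1/4\<close>, (5/4 * 1/3 + 1/4) / 12 = 1/18. From there on they reproduce
  themselves.\<close>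

lemma norm_deviation_later:
  assumes "2 \<le> k"
  shows "norm (deviation (x k)) \<le> 1 / 3 * M \<and> norm (deviation (y k)) \<le> 1 / 18 * M"
  using assms
proof (induction k rule: dec_induct)
  case base
  have "norm (deviation (x 2)) \<le> 1 / 3 * M"
    using norm_deviation_x_le[OF norm_deviation_first(2)] by (simp add: numeral_2_eq_2)
  thus ?case
    using norm_deviation_y[of 1] norm_deviation_first(1) by (simp add: beta_def numeral_2_eq_2)
next
  case (step k)
  have k: "9 \<le> (real (Suc k))\<^sup>2"
    using power_mono[of 3 "real (Suc k)" 2] step.hyps by simp
  have "norm (deviation (x (Suc k))) \<le> (1 + 1 / 18) * M / (real (Suc k))\<^sup>2"
    using step.IH by (intro norm_deviation_x_le) auto
  also have "\<dots> \<le> (1 + 1 / 18) * M / 9"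
    using k M_nonneg by (intro divide_left_mono) auto
  finally have x: "norm (deviation (x (Suc k))) \<le> 1 / 3 * M"
    using M_nonneg by simp
  have "norm (deviation (y (Suc k))) \<le> M / (3 * (real (Suc k))\<^sup>2)"
    using x step.IH by (intro norm_deviation_y_le) auto
  also have "\<dots> \<le> M / 18"
    using k M_nonneg by (intro divide_left_mono) auto
  finally show ?case using x by simp
qed

lemma norm_deviation_y_decay:
  assumes "1 \<le> k"
  shows "norm (deviation (y k)) \<le> M / (3 * (real k)\<^sup>2)"
proof -
  \<comment> \<open>k = 2 is separate because x(1) is only bounded by M; there 1/18 \<le> 1/12
    suffices.\<close>
  consider "k = 1" | "k = 2" | m where "k = Suc m" "2 \<le> m"
    using assms by (metis One_nat_def Suc_1 Suc_le_mono le_SucE le_antisym not_less_eq_eq Suc_le_D)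
  thus ?thesis
  proof cases
    case 1
    thus ?thesis using norm_deviation_first by simp
  next
    case 2
    thus ?thesis using norm_deviation_later[of 2] M_nonneg by simp
  next
    case 3
    thus ?thesis
      using norm_deviation_y_le[of m] norm_deviation_later[of k] norm_deviation_later[of m] by simp
  qed
qed

section \<open>The mean objective and Nesterov's analysis of the averages\<close>

lemma fmean_minimizer: "fmean xstar \<le> fmean z"
  unfolding fmean_def by (intro divide_right_mono minimizer) simp

lemma fmean_diff_le: "fmean u - fmean v \<le> G * norm (u - v)"
proof -
  have "f j u - f j v \<le> G * norm (u - v)" for j
  proof -
    have "f j u - f j v \<le> gradf j u \<bullet> (u - v)"
      using convex_above_tangent[OF convex grad, of j u v] by (simp add: inner_diff_right)
    also have "\<dots> \<le> norm (gradf j u) * norm (u - v)"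
      by (rule norm_cauchy_schwarz)
    also have "\<dots> \<le> G * norm (u - v)"
      by (intro mult_right_mono bounded_grad) simp
    finally show ?thesis .
  qed
  hence "(\<Sum>j\<in>UNIV. f j u - f j v) \<le> (\<Sum>j\<in>(UNIV::'n set). G * norm (u - v))"
    by (rule sum_mono)
  thus ?thesis
    by (simp add: fmean_def sum_subtractf divide_simps mult.commute)
qed

lemma fmean_descent: "fmean v \<le> fmean u + gmean u \<bullet> (v - u) + L / 2 * (norm (v - u))\<^sup>2"
proof -
  have "(\<Sum>j\<in>UNIV. f j v) \<le> (\<Sum>j\<in>UNIV. f j u + gradf j u \<bullet> (v - u) + L / 2 * (norm (v - u))\<^sup>2)"
    by (intro sum_mono descent_lemma grad lip)
  also have "\<dots> = (\<Sum>j\<in>UNIV. f j u) + (\<Sum>j\<in>UNIV. gradf j u) \<bullet> (v - u)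
      + real CARD('n) * (L / 2 * (norm (v - u))\<^sup>2)"
    by (simp add: sum.distrib inner_sum_left)
  finally show ?thesis
    by (simp add: fmean_def gmean_def node_average_def divide_simps algebra_simps)
qed

text \<open>The averaged step is a gradient step with an inexact first-order oracle, whose error is
  governed by the disagreement of \<open>y\<close>.\<close>

lemma inexact_oracle:
  "fmean (xbar (Suc k)) \<le> fmean z + gbar k \<bullet> (ybar k - z) - \<alpha> / 2 * (norm (gbar k))\<^sup>2
     + L * (norm (deviation (y k)))\<^sup>2 / real CARD('n)"
proof -
  let ?n = "real CARD('n)" and ?p = "xbar (Suc k)"
  have step: "norm (?p - ybar k) = \<alpha> * norm (gbar k)"
    using alpha_pos by (simp add: xbar_Suc)
  \<comment> \<open>The descent lemma and the tangent bound are both based at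
    \<open>y k $ j\<close>, so they share one gradient; the squared distance is split into averaged
    step and deviation.\<close>
  have "f j ?p \<le> f j z + g k $ j \<bullet> (?p - z) + L * \<alpha>\<^sup>2 * (norm (gbar k))\<^sup>2 + L * (norm (deviation (y k) $ j))\<^sup>2"
    for j
  proof -
    have "(norm (?p - y k $ j))\<^sup>2 = (norm ((?p - ybar k) - deviation (y k) $ j))\<^sup>2"
      by (simp add: deviation_def)
    also have "\<dots> \<le> 2 * (norm (?p - ybar k))\<^sup>2 + 2 * (norm (deviation (y k) $ j))\<^sup>2"
      by (rule norm_diff_squared_le)
    finally have "L / 2 * (norm (?p - y k $ j))\<^sup>2
        \<le> L / 2 * (2 * (norm (?p - ybar k))\<^sup>2 + 2 * (norm (deviation (y k) $ j))\<^sup>2)"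
      using L_nonneg by (intro mult_left_mono) auto
    also have "\<dots> = L * \<alpha>\<^sup>2 * (norm (gbar k))\<^sup>2 + L * (norm (deviation (y k) $ j))\<^sup>2"
      by (simp add: step power_mult_distrib algebra_simps)
    finally show ?thesis
      using descent_lemma[OF grad lip, of j ?p "y k $ j"]
        convex_above_tangent[OF convex grad, of j "y k $ j" z]
      by (simp add: stacked_gradient_def inner_diff_right)
  qed
  hence "(\<Sum>j\<in>UNIV. f j ?p) \<le> (\<Sum>j\<in>UNIV. f j z + g k $ j \<bullet> (?p - z)
      + L * \<alpha>\<^sup>2 * (norm (gbar k))\<^sup>2 + L * (norm (deviation (y k) $ j))\<^sup>2)"
    by (rule sum_mono)
  also have "\<dots> = (\<Sum>j\<in>UNIV. f j z) + ?n * (gbar k \<bullet> (?p - z)) + ?n * (L * \<alpha>\<^sup>2 * (norm (gbar k))\<^sup>2)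
      + L * (norm (deviation (y k)))\<^sup>2"
    by (simp add: sum.distrib sum_distrib_left norm_vec_squared[of "deviation (y k)"] sum_eq_node_average
        flip: inner_sum_left)
  finally have "fmean ?p \<le> fmean z + gbar k \<bullet> (?p - z) + L * \<alpha>\<^sup>2 * (norm (gbar k))\<^sup>2
      + L * (norm (deviation (y k)))\<^sup>2 / ?n"
    by (simp add: fmean_def divide_simps algebra_simps)
  moreover have "gbar k \<bullet> (?p - z) = gbar k \<bullet> (ybar k - z) - \<alpha> * (norm (gbar k))\<^sup>2"
    by (simp add: xbar_Suc inner_diff_right power2_norm_eq_inner)
  \<comment> \<open>The splitting doubled the smoothness term, hence the step size limit 1 / (2 L)
    rather than 1 / L.\<close>
  moreover have "L * \<alpha>\<^sup>2 * (norm (gbar k))\<^sup>2 \<le> \<alpha> / 2 * (norm (gbar k))\<^sup>2"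
    using mult_left_mono[OF step_size, of \<alpha>] alpha_pos
    by (intro mult_right_mono) (auto simp: power2_eq_square mult_ac)
  ultimately show ?thesis by linarith
qed

text \<open>Nesterov's auxiliary sequence, along which the averaged steps telescope.\<close>

definition momentum :: "nat \<Rightarrow> real^'d" where
  "momentum s = (real (s + 2) / 2) *\<^sub>R ybar s - (real s / 2) *\<^sub>R xbar s"

lemma momentum_0: "momentum 0 = xbar 0"
  by (simp add: momentum_def y_0)

text \<open>Since (s + 3) / 2 * beta s = s / 2, the extrapolation recombines into a plain gradient
  step of the auxiliary point.\<close>

lemma momentum_Suc: "momentum (Suc s) = momentum s - (\<alpha> * (real (s + 2) / 2)) *\<^sub>R gbar s"
proof -
  have "real (s + 3) * beta s = real s" by (simp add: beta_def)
  hence "(real (Suc s + 2) / 2) *\<^sub>R ybar (Suc s)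
      = (real (s + 3) / 2) *\<^sub>R xbar (Suc s) + (real s / 2) *\<^sub>R (xbar (Suc s) - xbar s)"
    by (simp add: ybar_Suc scaleR_right_distrib numeral_3_eq_3)
  hence "momentum (Suc s) = (real (s + 3) / 2 + real s / 2 - real (Suc s) / 2) *\<^sub>R xbar (Suc s) - (real s / 2) *\<^sub>R xbar s"
    by (simp add: momentum_def algebra_simps)
  also have "real (s + 3) / 2 + real s / 2 - real (Suc s) / 2 = real (s + 2) / 2"
    by (simp add: field_simps)
  finally show ?thesis
    by (simp add: xbar_Suc momentum_def scaleR_right_diff_distrib mult.commute)
qed

lemma lyapunov_step:
  "(real (s + 2))\<^sup>2 / 4 * (fmean (xbar (Suc s)) - fmean xstar) + (norm (momentum (Suc s) - xstar))\<^sup>2 / (2 * \<alpha>)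
   \<le> real s * real (s + 2) / 4 * (fmean (xbar s) - fmean xstar) + (norm (momentum s - xstar))\<^sup>2 / (2 * \<alpha>)
     + (real (s + 2))\<^sup>2 / 4 * (L * (norm (deviation (y s)))\<^sup>2 / real CARD('n))"
proof -
  define t where "t = real (s + 2) / 2"
  define \<delta> where "\<delta> = L * (norm (deviation (y s)))\<^sup>2 / real CARD('n)"
  define q where "q = gbar s \<bullet> (momentum s - xstar)"
  define h where "h = (norm (gbar s))\<^sup>2"
  have t: "1 \<le> t" "real (s + 2) = 2 * t" "real s = 2 * (t - 1)" by (simp_all add: t_def field_simps)
  have mom: "momentum s = t *\<^sub>R ybar s - (t - 1) *\<^sub>R xbar s"
    unfolding momentum_def t by simp
  have "(norm (momentum (Suc s) - xstar))\<^sup>2 = (norm (momentum s - xstar - (\<alpha> * t) *\<^sub>R gbar s))\<^sup>2"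
    by (simp add: momentum_Suc t_def algebra_simps)
  also have "\<dots> = (norm (momentum s - xstar))\<^sup>2 - 2 * (\<alpha> * t) * q + (\<alpha> * t)\<^sup>2 * h"
    unfolding q_def h_def power2_norm_eq_inner
    by (simp add: inner_diff inner_commute power2_eq_square algebra_simps)
  finally have "(norm (momentum (Suc s) - xstar))\<^sup>2 / (2 * \<alpha>)
      = (norm (momentum s - xstar))\<^sup>2 / (2 * \<alpha>) - t * q + \<alpha> / 2 * t\<^sup>2 * h"
    using alpha_pos by (simp add: field_simps power2_eq_square)
  moreover have "(t - 1) * (gbar s \<bullet> (ybar s - xbar s)) + gbar s \<bullet> (ybar s - xstar) = q"
    by (simp add: q_def mom inner_diff_right algebra_simps)
  hence "t * q = t * (t - 1) * (gbar s \<bullet> (ybar s - xbar s)) + t * (gbar s \<bullet> (ybar s - xstar))"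
    by (metis distrib_left mult.assoc)
  \<comment> \<open>The oracle is used at \<open>xbar s\<close> with weight t (t - 1) and at
    \<open>xstar\<close> with weight t, in total t^2. The inner products add up to t q; they and the
    terms in h cancel against the squared distance.\<close>
  moreover have "t * (t - 1) * fmean (xbar (Suc s)) \<le> t * (t - 1) *
      (fmean (xbar s) + gbar s \<bullet> (ybar s - xbar s) - \<alpha> / 2 * h + \<delta>)"
    using t(1) inexact_oracle[of s "xbar s"] unfolding h_def \<delta>_def by (intro mult_left_mono) auto
  moreover have "t * fmean (xbar (Suc s)) \<le> t *
      (fmean xstar + gbar s \<bullet> (ybar s - xstar) - \<alpha> / 2 * h + \<delta>)"
    using t(1) inexact_oracle[of s xstar] unfolding h_def \<delta>_def by (intro mult_left_mono) auto
  ultimately have "t\<^sup>2 * (fmean (xbar (Suc s)) - fmean xstar) + (norm (momentum (Suc s) - xstar))\<^sup>2 / (2 * \<alpha>)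
      \<le> t * (t - 1) * (fmean (xbar s) - fmean xstar) + (norm (momentum s - xstar))\<^sup>2 / (2 * \<alpha>) + t\<^sup>2 * \<delta>"
    unfolding power2_eq_square[of t] by (simp only: algebra_simps)
  moreover have "(2 * t)\<^sup>2 / 4 = t\<^sup>2" "2 * (t - 1) * (2 * t) / 4 = t * (t - 1)"
    by simp_all
  ultimately show ?thesis
    unfolding \<delta>_def[symmetric] t(2,3) by (simp only:)
qed

text \<open>Telescoping works because (s + 1) (s + 3) \<le> (s + 2)^2 and the objective gap is
  nonnegative. The weight 0 at k = 0 removes the initial gap.\<close>

lemma lyapunov:
  "real k * real (k + 2) / 4 * (fmean (xbar k) - fmean xstar) + (norm (momentum k - xstar))\<^sup>2 / (2 * \<alpha>)
   \<le> (norm (xbar 0 - xstar))\<^sup>2 / (2 * \<alpha>)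
     + (\<Sum>s<k. (real (s + 2))\<^sup>2 / 4 * (L * (norm (deviation (y s)))\<^sup>2 / real CARD('n)))"
proof (induction k)
  case (Suc k)
  have "real (Suc k) * real (Suc k + 2) / 4 \<le> (real (k + 2))\<^sup>2 / 4"
    by (simp add: power2_eq_square algebra_simps)
  hence "real (Suc k) * real (Suc k + 2) / 4 * (fmean (xbar (Suc k)) - fmean xstar)
      \<le> (real (k + 2))\<^sup>2 / 4 * (fmean (xbar (Suc k)) - fmean xstar)"
    by (intro mult_right_mono) (auto simp: fmean_minimizer)
  thus ?case using Suc lyapunov_step[of k] unfolding sum.lessThan_Suc by linarith
qed (simp add: momentum_0)

lemma oracle_error_le:
  "(real (s + 2))\<^sup>2 / 4 * (L * (norm (deviation (y s)))\<^sup>2 / real CARD('n))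
   \<le> L * \<alpha>\<^sup>2 * G\<^sup>2 / 4 * (1 / (real s)\<^sup>2)"
\<comment> \<open>For s = 0 both sides vanish, by the common start and by 1 / 0 = 0. Otherwise s + 2
  \<le> 3 s, whose 3 cancels the one in the decay of y.\<close>
proof (cases "s = 0")
  case False
  have "(real (s + 2))\<^sup>2 \<le> (3 * real s)\<^sup>2"
    using False by (intro power_mono) auto
  moreover have "(norm (deviation (y s)))\<^sup>2 \<le> (M / (3 * (real s)\<^sup>2))\<^sup>2"
    using norm_deviation_y_decay[of s] False by (intro power_mono) auto
  ultimately have "(real (s + 2))\<^sup>2 / 4 * (L * (norm (deviation (y s)))\<^sup>2 / real CARD('n))
      \<le> (3 * real s)\<^sup>2 / 4 * (L * (M / (3 * (real s)\<^sup>2))\<^sup>2 / real CARD('n))"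
    using L_nonneg by (intro mult_mono divide_right_mono mult_left_mono) auto
  also have "\<dots> = L * \<alpha>\<^sup>2 * G\<^sup>2 / 4 * (1 / (real s)\<^sup>2)"
    using False by (simp add: M_def power2_eq_square field_simps)
  finally show ?thesis .
qed (simp add: deviation_0)

lemma fmean_xbar_le:
  assumes "norm (xbar 0 - xstar) \<le> R" and "1 \<le> k"
  shows "fmean (xbar k) - fmean xstar \<le> (2 / \<alpha> * R\<^sup>2 + 2 * \<alpha>\<^sup>2 * L * G\<^sup>2) / (real k)\<^sup>2"
proof -
  let ?v = "fmean (xbar k) - fmean xstar"
  have "(\<Sum>s<k. (real (s + 2))\<^sup>2 / 4 * (L * (norm (deviation (y s)))\<^sup>2 / real CARD('n)))
      \<le> (\<Sum>s<k. L * \<alpha>\<^sup>2 * G\<^sup>2 / 4 * (1 / (real s)\<^sup>2))"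
    by (intro sum_mono oracle_error_le)
  also have "\<dots> \<le> (\<Sum>s\<le>k. L * \<alpha>\<^sup>2 * G\<^sup>2 / 4 * (1 / (real s)\<^sup>2))"
    using L_nonneg by (intro sum_mono2) auto
  also have "\<dots> = L * \<alpha>\<^sup>2 * G\<^sup>2 / 4 * (\<Sum>s\<le>k. 1 / (real s)\<^sup>2)"
    by (simp add: sum_distrib_left)
  also have "\<dots> \<le> L * \<alpha>\<^sup>2 * G\<^sup>2 / 4 * 2"
    using L_nonneg order_trans[OF sum_inverse_squares_le[of k], of 2] by (intro mult_left_mono) auto
  finally have err: "(\<Sum>s<k. (real (s + 2))\<^sup>2 / 4 * (L * (norm (deviation (y s)))\<^sup>2 / real CARD('n)))
      \<le> L * \<alpha>\<^sup>2 * G\<^sup>2 / 2" by linarith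
  have start: "(norm (xbar 0 - xstar))\<^sup>2 / (2 * \<alpha>) \<le> R\<^sup>2 / (2 * \<alpha>)"
    using alpha_pos assms by (intro divide_right_mono power_mono) auto
  have "(real k)\<^sup>2 / 4 * ?v \<le> real k * real (k + 2) / 4 * ?v"
    using fmean_minimizer[of "xbar k"] by (intro mult_right_mono) (auto simp: power2_eq_square intro!: mult_left_mono)
  moreover have "0 \<le> (norm (momentum k - xstar))\<^sup>2 / (2 * \<alpha>)"
    using alpha_pos by simp
  ultimately have "(real k)\<^sup>2 / 4 * ?v \<le> R\<^sup>2 / (2 * \<alpha>) + L * \<alpha>\<^sup>2 * G\<^sup>2 / 2"
    using lyapunov[of k] err start by linarith
  thus ?thesis using assms alpha_pos by (simp add: field_simps)
qed

section \<open>From the average to a single node\<close>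

lemma norm_gmean_le:
  assumes "norm (deviation (y m)) \<le> b * M" and "norm (gbar m) \<le> q * G"
  shows "norm (gmean (xbar (Suc m))) \<le> G * (q + \<alpha> * L * (q + b))"
proof -
  let ?n = "real CARD('n)" and ?z = "xbar (Suc m)"
  have "norm (gradf j ?z - gradf j (y m $ j)) \<le> L * (\<alpha> * (q * G) + norm (deviation (y m) $ j))" for j
  proof -
    \<comment> \<open>The new average differs from \<open>y m $ j\<close> by the averaged step and
      the deviation, so small \<open>gbar m\<close> keeps the mean objective flat there.\<close>
    have "?z - y m $ j = - \<alpha> *\<^sub>R gbar m - deviation (y m) $ j"
      by (simp add: xbar_Suc deviation_def)
    hence "norm (?z - y m $ j) \<le> \<alpha> * norm (gbar m) + norm (deviation (y m) $ j)"
      using norm_triangle_ineq4[of "- \<alpha> *\<^sub>R gbar m" "deviation (y m) $ j"] alpha_pos by simp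
    also have "\<dots> \<le> \<alpha> * (q * G) + norm (deviation (y m) $ j)"
      using assms(2) alpha_pos by simp
    finally show ?thesis
      using lip[of j ?z "y m $ j"] L_nonneg by (meson mult_left_mono order_trans)
  qed
  hence "norm (\<Sum>j\<in>UNIV. gradf j ?z - gradf j (y m $ j))
      \<le> (\<Sum>j\<in>UNIV. L * (\<alpha> * (q * G) + norm (deviation (y m) $ j)))"
    by (intro sum_norm_le)
  also have "\<dots> = L * (?n * (\<alpha> * (q * G)) + (\<Sum>j\<in>UNIV. norm (deviation (y m) $ j)))"
    by (simp add: sum.distrib flip: sum_distrib_left)
  also have "\<dots> \<le> L * (?n * (\<alpha> * (q * G)) + sqrt ?n * (b * M))"
    using L_nonneg order_trans[OF mean_norm_le mult_left_mono[OF assms(1), of "sqrt ?n"]]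
    by (intro mult_left_mono add_left_mono) auto
  \<comment> \<open>One sqrt N comes from Cauchy-Schwarz, the other from \<open>M\<close>; the
    resulting N cancels in the mean.\<close>
  also have "sqrt ?n * (b * M) = (sqrt ?n * sqrt ?n) * (b * (\<alpha> * G))"
    by (simp only: M_def mult_ac)
  also have "sqrt ?n * sqrt ?n = ?n"
    by simp
  also have "L * (?n * (\<alpha> * (q * G)) + ?n * (b * (\<alpha> * G))) = ?n * (G * (\<alpha> * L * (q + b)))"
    by (simp only: algebra_simps)
  finally have "norm (gmean ?z - gbar m) \<le> G * (\<alpha> * L * (q + b))"
    by (simp add: gmean_def node_average_def stacked_gradient_def sum_subtractf divide_simps mult.commute
        flip: scaleR_right_diff_distrib)
  thus ?thesis
    using norm_triangle_sub[of "gmean ?z" "gbar m"] assms(2) by (simp add: algebra_simps)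
qed

text \<open>The gossiped gradients are bounded blockwise, so their share 2 \<alpha> G carries no
  sqrt N.\<close>

lemma norm_deviation_component_le:
  assumes "norm (deviation (y m)) \<le> b * M"
  shows "norm (deviation (x (Suc m)) $ i) \<le> b * M / (real (Suc m))\<^sup>2 + 2 * (\<alpha> * G)"
proof -
  let ?P = "gossip W ^^ tau_x W (Suc m)"
  have "deviation (x (Suc m)) = deviation (?P (y m)) - \<alpha> *\<^sub>R deviation (?P (g m))"
    by (simp add: x_Suc gossip_funpow_diff gossip_funpow_scaleR deviation_diff deviation_scaleR)
  hence "norm (deviation (x (Suc m)) $ i) \<le> norm (deviation (?P (y m)) $ i) + \<alpha> * norm (deviation (?P (g m)) $ i)"
    using norm_triangle_ineq4[of "deviation (?P (y m)) $ i" "\<alpha> *\<^sub>R deviation (?P (g m)) $ i"] alpha_pos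
    by simp
  moreover have "norm (deviation (?P (y m)) $ i) \<le> b * M / (real (Suc m))\<^sup>2"
  proof -
    have "norm (deviation (?P (y m)) $ i) \<le> norm (deviation (?P (y m)))"
      by (rule Finite_Cartesian_Product.norm_nth_le)
    also have "\<dots> \<le> mu W ^ tau_x W (Suc m) * norm (deviation (y m))"
      by (rule norm_deviation_gossip_funpow[OF stoch])
    also have "\<dots> \<le> 1 / (real (Suc m))\<^sup>2 * (b * M)"
      using assms by (intro mult_mono mu_power_tau_x[OF mu]) auto
    finally show ?thesis by simp
  qed
  moreover have "norm (deviation (?P (g m)) $ i) \<le> 2 * G"
  proof -
    have "norm (?P (g m) $ i) \<le> G"
      by (rule norm_gossip_funpow_component[OF stoch]) (simp add: stacked_gradient_def bounded_grad)
    moreover have "norm (node_average (?P (g m))) \<le> G"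
      by (simp add: node_average_gossip_funpow[OF stoch] norm_gbar)
    ultimately show ?thesis
      using norm_triangle_ineq4[of "?P (g m) $ i" "node_average (?P (g m))"] by (simp add: deviation_def)
  qed
  hence "\<alpha> * norm (deviation (?P (g m)) $ i) \<le> \<alpha> * (2 * G)"
    using alpha_pos by simp
  ultimately show ?thesis by simp
qed

text \<open>Sharpens \<open>norm_deviation_x_le\<close> through sqrt (1 - q^2) \<le> 1 - q^2 /
  2.\<close>

lemma norm_deviation_x_gbar_le:
  assumes "norm (deviation (y m)) \<le> b * M" and "norm (gbar m) = q * G" and "0 \<le> q" "q \<le> 1"
  shows "norm (deviation (x (Suc m))) \<le> (b + (1 - q\<^sup>2 / 2)) * M / (real (Suc m))\<^sup>2"
proof -
  have q: "q\<^sup>2 \<le> 1" using assms by (simp add: power_le_one)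
  have "(norm (deviation (g m)))\<^sup>2 \<le> real CARD('n) * (G\<^sup>2 - (q * G)\<^sup>2)"
    using norm_deviation_g[of m] assms(2) by simp
  also have "\<dots> = real CARD('n) * (G\<^sup>2 * (1 - q\<^sup>2))"
    by (simp add: power_mult_distrib algebra_simps)
  also have "\<dots> \<le> real CARD('n) * (G\<^sup>2 * (1 - q\<^sup>2 / 2)\<^sup>2)"
    by (intro mult_left_mono) (auto simp: power2_diff)
  also have "\<dots> = (sqrt (real CARD('n)) * G * (1 - q\<^sup>2 / 2))\<^sup>2"
    by (simp add: power_mult_distrib)
  finally have "norm (deviation (g m)) \<le> sqrt (real CARD('n)) * G * (1 - q\<^sup>2 / 2)"
    by (rule power2_le_imp_le) (use G_nonneg q in auto)
  hence "\<alpha> * norm (deviation (g m)) \<le> M * (1 - q\<^sup>2 / 2)"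
    using alpha_pos unfolding M_def by simp
  hence "norm (deviation (y m)) + \<alpha> * norm (deviation (g m)) \<le> (b + (1 - q\<^sup>2 / 2)) * M"
    using assms(1) by (simp add: algebra_simps)
  thus ?thesis
    using norm_deviation_x[of m] by (meson divide_right_mono order_trans zero_le_power2)
qed

text \<open>Here \<open>b\<close> bounds the disagreement of \<open>y\<close>, and \<open>q\<close> and \<open>l\<close> stand for \<open>\<parallel>gbar m\<parallel> / G\<close> and \<open>\<alpha> L\<close>. The
  segment from \<open>xbar\<close> to the node is split at distance \<open>c M / (m + 1)\<^sup>2\<close>: up to there the descent
  lemma is used, and the slope bound \<open>G\<close> beyond. The factor \<open>3\<close> comes from
  \<open>\<surd>N \<le> 3 (m + 1)\<^sup>2\<close>, which holds whenever the disagreement of \<open>x\<close> at the node exceeds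
  \<open>M / (m + 1)\<^sup>2\<close>, because the gossip weights are stochastic.\<close>

lemma node_gap:
  assumes dy: "norm (deviation (y m)) \<le> b * M"
    and b: "0 \<le> b" "b \<le> 1 / 3" and c: "0 \<le> c" "c \<le> 1" and S: "0 \<le> S"
    and cond: "\<And>q l. 0 \<le> q \<Longrightarrow> q \<le> 1 \<Longrightarrow> 0 \<le> l \<Longrightarrow> l \<le> 1 / 2 \<Longrightarrow>
      3 * (b - q\<^sup>2 / 2 - c * (1 - q) + l * c * (q + b + 3 / 2 * c)) \<le> S * l / (real (Suc m))\<^sup>2"
  shows "fmean (x (Suc m) $ i) - fmean (xbar (Suc m))
    \<le> \<alpha> * G\<^sup>2 * (sqrt (real CARD('n)) + S * (\<alpha> * L)) / (real (Suc m))\<^sup>2"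
proof -
  \<comment> \<open>In these units M / (m + 1)^2 is n \<alpha> G, and \<open>e\<close> below is the
    excess over n that the claim allows.\<close>
  define n where "n = sqrt (real CARD('n)) / (real (Suc m))\<^sup>2"
  define l where "l = \<alpha> * L"
  define z where "z = xbar (Suc m)"
  define D where "D = deviation (x (Suc m)) $ i"
  define e where "e = S * l / (real (Suc m))\<^sup>2"
  have l: "0 \<le> l" "l \<le> 1 / 2" using L_nonneg alpha_pos step_size by (simp_all add: l_def)
  have n: "0 \<le> n" by (simp add: n_def)
  have e: "0 \<le> e" using S l by (simp add: e_def)
  have aG: "0 \<le> \<alpha> * G" "0 \<le> \<alpha> * G\<^sup>2" using alpha_pos G_nonneg by auto
  have M: "M / (real (Suc m))\<^sup>2 = n * (\<alpha> * G)" by (simp add: M_def n_def)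
  have xi: "x (Suc m) $ i = z + D" by (simp add: z_def D_def deviation_def)
  have "fmean (z + D) - fmean z \<le> \<alpha> * G\<^sup>2 * (n + e)"
  proof (cases "norm D \<le> n * (\<alpha> * G)")
    case True
    have "fmean (z + D) - fmean z \<le> G * norm D" using fmean_diff_le[of "z + D" z] by simp
    also have "\<dots> \<le> G * (n * (\<alpha> * G))" using True G_nonneg by (intro mult_left_mono)
    also have "\<dots> = \<alpha> * G\<^sup>2 * n" by (simp add: power2_eq_square)
    also have "\<dots> \<le> \<alpha> * G\<^sup>2 * (n + e)" using aG e by (intro mult_left_mono) auto
    finally show ?thesis .
  next
    case False
    have D_le: "norm D \<le> b * (n * (\<alpha> * G)) + 2 * (\<alpha> * G)"
      using norm_deviation_component_le[OF dy, of i] M by (simp add: D_def times_divide_eq_right[symmetric] del: times_divide_eq_right)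
    have "G \<noteq> 0" using False D_le by auto
    have n3: "n \<le> 3"
    proof -
      have "0 < \<alpha> * G" using \<open>G \<noteq> 0\<close> G_nonneg alpha_pos by simp
      moreover have "n * (\<alpha> * G) < (b * n + 2) * (\<alpha> * G)" using False D_le by (simp add: algebra_simps)
      ultimately have "n < b * n + 2" by (rule mult_right_less_imp_less[rotated, OF less_imp_le])
      moreover have "b * n \<le> 1 / 3 * n" using b n by (intro mult_right_mono)
      ultimately show ?thesis by simp
    qed
    define q where "q = norm (gbar m) / G"
    have q: "0 \<le> q" "q \<le> 1" "norm (gbar m) = q * G"
      using G_nonneg norm_gbar[of m] \<open>G \<noteq> 0\<close> by (auto simp: q_def divide_le_eq)
    define w where "w = c * (n * (\<alpha> * G))"
    have w: "0 \<le> w" "w \<le> norm D"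
      using c n aG False mult_right_mono[of c 1 "n * (\<alpha> * G)"] by (auto simp: w_def)
    \<comment> \<open>The displacement to the point where the two slope estimates meet.\<close>
    define p where "p = (w / norm D) *\<^sub>R D"
    have "D \<noteq> 0" using False n aG by auto
    have p: "norm p = w" "norm (D - p) = norm D - w"
    proof -
      show "norm p = w" using \<open>D \<noteq> 0\<close> w by (simp add: p_def)
      have "D - p = (1 - w / norm D) *\<^sub>R D" by (simp add: p_def scaleR_left_diff_distrib)
      hence "norm (D - p) = \<bar>1 - w / norm D\<bar> * norm D" by (simp only: norm_scaleR)
      also have "\<bar>1 - w / norm D\<bar> = 1 - w / norm D" using \<open>D \<noteq> 0\<close> w by simp
      finally show "norm (D - p) = norm D - w" using \<open>D \<noteq> 0\<close> by (simp add: left_diff_distrib)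
    qed
    have "fmean (z + D) - fmean (z + p) \<le> G * (norm D - w)"
      using fmean_diff_le[of "z + D" "z + p"] p by simp
    moreover have "norm D \<le> (b + (1 - q\<^sup>2 / 2)) * (n * (\<alpha> * G))"
      using Finite_Cartesian_Product.norm_nth_le[of "deviation (x (Suc m))" i]
        norm_deviation_x_gbar_le[OF dy q(3,1,2)] M
      by (simp add: D_def times_divide_eq_right[symmetric] del: times_divide_eq_right)
    hence "G * (norm D - w) \<le> G * ((b + (1 - q\<^sup>2 / 2)) * (n * (\<alpha> * G)) - w)"
      using G_nonneg by (intro mult_left_mono) auto
    moreover have "fmean (z + p) - fmean z \<le> G * (q + l * (q + b)) * w + L / 2 * w\<^sup>2"
    proof -
      have "gmean z \<bullet> p \<le> norm (gmean z) * norm p" by (rule norm_cauchy_schwarz)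
      also have "\<dots> \<le> G * (q + l * (q + b)) * w"
        unfolding p using w norm_gmean_le[OF dy, of q] q by (intro mult_right_mono) (auto simp: z_def l_def)
      finally show ?thesis using fmean_descent[of "z + p" z] p by simp
    qed
    \<comment> \<open>Adds both pieces of the path and isolates the excess over \<alpha> G^2
      n.\<close>
    moreover have "G * ((b + (1 - q\<^sup>2 / 2)) * (n * (\<alpha> * G)) - w) + (G * (q + l * (q + b)) * w + L / 2 * w\<^sup>2)
        = \<alpha> * G\<^sup>2 * (n + n * (b - q\<^sup>2 / 2 - c * (1 - q) + l * c * (q + b + n / 2 * c)))"
      by (simp add: w_def l_def power2_eq_square algebra_simps)
    moreover have "n * (b - q\<^sup>2 / 2 - c * (1 - q) + l * c * (q + b + n / 2 * c)) \<le> e"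
    proof -
      define E where "E = b - q\<^sup>2 / 2 - c * (1 - q) + l * c * (q + b + 3 / 2 * c)"
      have "b - q\<^sup>2 / 2 - c * (1 - q) + l * c * (q + b + n / 2 * c) \<le> E"
        unfolding E_def using n3 c l by (intro add_left_mono mult_left_mono mult_right_mono) auto
      hence "n * (b - q\<^sup>2 / 2 - c * (1 - q) + l * c * (q + b + n / 2 * c)) \<le> n * E"
        using n by (rule mult_left_mono)
      also have "\<dots> \<le> e"
      \<comment> \<open>n \<le> 3 helps only for nonnegative E; otherwise n E is nonpositive
        anyway.\<close>
      proof (cases "0 \<le> E")
        case True
        hence "n * E \<le> 3 * E" using n3 by (rule mult_right_mono[rotated])
        thus ?thesis using cond[OF q(1,2) l] by (simp add: E_def e_def)
      next
        case False
        thus ?thesis using n e mult_nonneg_nonpos[of n E] by linarith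
      qed
      finally show ?thesis .
    qed
    hence "\<alpha> * G\<^sup>2 * (n + n * (b - q\<^sup>2 / 2 - c * (1 - q) + l * c * (q + b + n / 2 * c))) \<le> \<alpha> * G\<^sup>2 * (n + e)"
      using aG by (intro mult_left_mono) auto
    ultimately show ?thesis by linarith
  qed
  also have "\<alpha> * G\<^sup>2 * (n + e) = \<alpha> * G\<^sup>2 * (sqrt (real CARD('n)) + S * (\<alpha> * L)) / (real (Suc m))\<^sup>2"
    by (simp only: n_def e_def l_def times_divide_eq_right flip: add_divide_distrib)
  finally show ?thesis by (simp add: xi z_def)
qed

text \<open>Here b is the bound for y(0), y(1) or later y. Only k = 2, where b = 1/3, uses a
  positive S; afterwards b = 1/18 is small enough for S = 0.\<close>

lemma node_gap_le:
  assumes "1 \<le> k"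
  shows "fmean (x k $ i) - fmean (xbar k) \<le> \<alpha> * G\<^sup>2 * (sqrt (real CARD('n)) + 9 * (\<alpha> * L)) / (real k)\<^sup>2"
proof -
  consider "k = 1" | "k = 2" | m where "k = Suc m" "2 \<le> m"
    using assms by (metis One_nat_def Suc_1 Suc_le_mono le_SucE le_antisym not_less_eq_eq Suc_le_D)
  hence "\<exists>S. 0 \<le> S \<and> S \<le> 9 \<and> fmean (x k $ i) - fmean (xbar k)
      \<le> \<alpha> * G\<^sup>2 * (sqrt (real CARD('n)) + S * (\<alpha> * L)) / (real k)\<^sup>2"
  proof cases
    case 1
    thus ?thesis using node_gap[of 0 0 0 0 i] by (intro exI[of _ 0]) (simp add: deviation_0)
  next
    case 2
    have "fmean (x (Suc 1) $ i) - fmean (xbar (Suc 1))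
        \<le> \<alpha> * G\<^sup>2 * (sqrt (real CARD('n)) + 9 * (\<alpha> * L)) / (real (Suc 1))\<^sup>2"
    proof (rule node_gap[of 1 "1 / 3" "9 / 20"])
      fix q l :: real assume q: "0 \<le> q" "q \<le> 1" and l: "0 \<le> l" "l \<le> 1 / 2"
      \<comment> \<open>The condition is affine in l, so l = 0 and l = 1/2 suffice; there its sides
        differ by A and B. These quadratics in q peak at 9/20 and 27/40, with negative
        values.\<close>
      define A where "A = 27 / 20 * q - 3 / 2 * q\<^sup>2 - 7 / 20"
      define B where "B = 81 / 40 * q - 3 / 2 * q\<^sup>2 - 1271 / 1600"
      have "A \<le> 0" using zero_le_power2[of "q - 9 / 20"] by (simp add: A_def power2_eq_square algebra_simps)
      moreover have "B \<le> 0" using zero_le_power2[of "q - 27 / 40"] by (simp add: B_def power2_eq_square algebra_simps)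
      ultimately have "(1 - 2 * l) * A + 2 * l * B \<le> 0"
        using l by (intro add_nonpos_nonpos mult_nonneg_nonpos) auto
      moreover have "(1 - 2 * l) * A + 2 * l * B =
          3 * (1 / 3 - q\<^sup>2 / 2 - 9 / 20 * (1 - q) + l * (9 / 20) * (q + 1 / 3 + 3 / 2 * (9 / 20))) - 9 * l / (real (Suc 1))\<^sup>2"
        by (simp add: A_def B_def field_simps)
      ultimately show "3 * (1 / 3 - q\<^sup>2 / 2 - 9 / 20 * (1 - q) + l * (9 / 20) * (q + 1 / 3 + 3 / 2 * (9 / 20))) \<le> 9 * l / (real (Suc 1))\<^sup>2"
        by linarith
    qed (use norm_deviation_first in auto)
    thus ?thesis using 2 by (intro exI[of _ 9]) (simp add: numeral_2_eq_2)
  next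
    case 3
    have "fmean (x (Suc m) $ i) - fmean (xbar (Suc m))
        \<le> \<alpha> * G\<^sup>2 * (sqrt (real CARD('n)) + 0 * (\<alpha> * L)) / (real (Suc m))\<^sup>2"
    proof (rule node_gap[of m "1 / 18" "1 / 10"])
      fix q l :: real assume q: "0 \<le> q" "q \<le> 1" and l: "0 \<le> l" "l \<le> 1 / 2"
      \<comment> \<open>The worst case is l = 1/2, which leaves a quadratic in q with a negative
        maximum at 3/20.\<close>
      have "l * (q + 37 / 180) \<le> 1 / 2 * (q + 37 / 180)"
        using q l by (intro mult_right_mono) auto
      thus "3 * (1 / 18 - q\<^sup>2 / 2 - 1 / 10 * (1 - q) + l * (1 / 10) * (q + 1 / 18 + 3 / 2 * (1 / 10))) \<le> 0 * l / (real (Suc m))\<^sup>2"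
        using zero_le_power2[of "q - 3 / 20"] by (simp add: power2_eq_square field_simps)
    qed (use norm_deviation_later[of m] 3 in auto)
    thus ?thesis using 3 by (intro exI[of _ 0]) simp
  qed
  then obtain S where S: "S \<le> 9" "fmean (x k $ i) - fmean (xbar k)
      \<le> \<alpha> * G\<^sup>2 * (sqrt (real CARD('n)) + S * (\<alpha> * L)) / (real k)\<^sup>2"
    by blast
  note S(2)
  also have "\<alpha> * G\<^sup>2 * (sqrt (real CARD('n)) + S * (\<alpha> * L)) / (real k)\<^sup>2
      \<le> \<alpha> * G\<^sup>2 * (sqrt (real CARD('n)) + 9 * (\<alpha> * L)) / (real k)\<^sup>2"
    using S(1) alpha_pos L_nonneg by (intro divide_right_mono mult_left_mono add_left_mono mult_right_mono) auto
  finally show ?thesis .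
qed

text \<open>The 11 is 2 from the inexact oracle plus 9 from the node gap.\<close>

lemma fmean_node_le:
  assumes "norm (xbar 0 - xstar) \<le> R" and "1 \<le> k"
  shows "fmean (x k $ i) - fmean xstar
    \<le> 1 / (real k)\<^sup>2 * (2 / \<alpha> * R\<^sup>2 + 11 * \<alpha>\<^sup>2 * L * G\<^sup>2 + \<alpha> * sqrt (real CARD('n)) * G\<^sup>2)"
proof -
  have "fmean (x k $ i) - fmean xstar
      \<le> \<alpha> * G\<^sup>2 * (sqrt (real CARD('n)) + 9 * (\<alpha> * L)) / (real k)\<^sup>2
        + (2 / \<alpha> * R\<^sup>2 + 2 * \<alpha>\<^sup>2 * L * G\<^sup>2) / (real k)\<^sup>2"
    using node_gap_le[OF assms(2), of i] fmean_xbar_le[OF assms] by linarith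
  also have "\<dots> = 1 / (real k)\<^sup>2 * (2 / \<alpha> * R\<^sup>2 + 11 * \<alpha>\<^sup>2 * L * G\<^sup>2 + \<alpha> * sqrt (real CARD('n)) * G\<^sup>2)"
    unfolding add_divide_distrib[symmetric] times_divide_eq_left mult_1_left
    by (rule arg_cong[of _ _ "\<lambda>a. a / (real k)\<^sup>2"]) (simp add: power2_eq_square algebra_simps)
  finally show ?thesis .
qed

end

subsection \<open>Convergence of D--NC\<close>

text \<open>The ceilings force at least one round however small \<open>mu W\<close> is, so the round
  bound comes with an extra 2 k in general and without it for \<open>mu W\<close> away from
  0.\<close>

theorem theorem8:
  fixes E :: "'n::finite set set"
    and W :: "real^'n^'n"
    and f :: "'n \<Rightarrow> real^'d \<Rightarrow> real"
    and gradf :: "'n \<Rightarrow> real^'d \<Rightarrow> real^'d"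
    and x y :: "nat \<Rightarrow> real^'d^'n"
    and \<alpha> L G R :: real
    and xstar :: "real^'d"
  assumes "CARD('n) \<ge> 2"
    and "simple_graph E" and "connected_graph E"
    and "weight_matrix E W"
    and "0 < mu W" and "mu W < 1"
    and "\<And>i. convex_on UNIV (f i)"
    and "\<And>i z. GDERIV (f i) z :> gradf i z"
    and "\<And>i u v. norm (gradf i u - gradf i v) \<le> L * norm (u - v)"
    and "\<And>i z. norm (gradf i z) \<le> G"
    and "\<And>z. (\<Sum>i\<in>UNIV. f i xstar) \<le> (\<Sum>i\<in>UNIV. f i z)"
    and "0 < \<alpha>" and "L \<noteq> 0 \<Longrightarrow> \<alpha> \<le> 1 / (2 * L)"
    and "D_NC W gradf \<alpha> x y"
    and "0 \<le> R" and "norm (node_average (x 0) - xstar) \<le> R"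
  shows "(\<forall>k\<ge>1. \<forall>i.
            1 / real CARD('n) * ((\<Sum>j\<in>UNIV. f j (x k $ i)) - (\<Sum>j\<in>UNIV. f j xstar))
              \<le> 1 / (real k)\<^sup>2 *
                 (2 / \<alpha> * R\<^sup>2 + 11 * \<alpha>\<^sup>2 * L * G\<^sup>2 + \<alpha> * sqrt (real CARD('n)) * G\<^sup>2)) \<and>
         (\<forall>k\<ge>1. real (comm_rounds W k)
              \<le> 2 / - ln (mu W) *
                 (real k * ln 3 + 2 * (real k + 1) * ln (real k + 1)) + 2 * real k) \<and>
         (1 / 12 \<le> mu W \<longrightarrow>
            (\<forall>k\<ge>1. real (comm_rounds W k)
              \<le> 2 / - ln (mu W) *
                 (real k * ln 3 + 2 * (real k + 1) * ln (real k + 1)))) \<and>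
         (\<lambda>k. real (comm_rounds W k)) \<in> O(\<lambda>k. real k * ln (real k))"
proof -
  have stoch: "doubly_stochastic W"
    using assms(4) by (simp add: weight_matrix_def)
  \<comment> \<open>The Lipschitz bound at two distinct points, a unit vector and 0, yields L \<ge>
    0.\<close>
  have "0 \<le> L * norm (axis undefined 1 - 0 :: real^'d)"
    using assms(9) norm_ge_zero order_trans by blast
  hence L: "0 \<le> L" by (simp add: zero_le_mult_iff)
  have step: "\<alpha> * L \<le> 1 / 2"
    using assms(13) L by (cases "L = 0") (auto simp: field_simps)
  interpret dnc_run W f gradf x y \<alpha> L G "\<alpha> * (sqrt (real CARD('n)) * G)" xstar
    using assms stoch L step by unfold_locales auto
  have "1 / real CARD('n) * ((\<Sum>j\<in>UNIV. f j (x k $ i)) - (\<Sum>j\<in>UNIV. f j xstar))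
      \<le> 1 / (real k)\<^sup>2 * (2 / \<alpha> * R\<^sup>2 + 11 * \<alpha>\<^sup>2 * L * G\<^sup>2 + \<alpha> * sqrt (real CARD('n)) * G\<^sup>2)"
    if "1 \<le> k" for k i
    using fmean_node_le[OF assms(16) that, of i] by (simp add: fmean_def diff_divide_distrib)
  thus ?thesis
    using comm_rounds_le[OF assms(5,6)] comm_rounds_le'[OF assms(5,6)] comm_rounds_bigo[OF assms(5,6)]
    by blast
qed

end
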